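(* Let $\omega=\omega(n)$ be a nondecreasing, integer-valued function tending to infinity, and let $\{G_n\}_{n\in I}$ be a family of graphs, where $G_n$ is of order $n$. If $G_n$ has at most $O(\sqrt n)$ vertices of degree $o(\sqrt n)$, then $G_n$ has domination number $O(\omega\sqrt n\log n)$ (as $n\to\infty$ in $I$).
   Context: All graphs are finite, simple, undirected and connected; $I$ is an infinite set of positive integers; logarithms are base $2$. The hypothesis "$G_n$ has at most $O(\sqrt n)$ vertices of degree $o(\sqrt n)$" means: for every nonnegative function $f$ with $f(n)=o(\sqrt n)$, the number of vertices of $G_n$ of degree at most $f(n)$ is $O(\sqrt n)$. The domination number of $G$ is the minimum cardinality of a set $S$ of vertices such that every vertex not in $S$ has a neighbor in $S$. *)

theory Defs
  imports
    Complex_Main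
    "HOL-Library.Landau_Symbols"
    "Graph_Theory.Digraph"
    "Graph_Theory.Digraph_Component"
begin

text \<open>
  Finite simple undirected graphs are those satisfying the locale predicate \<^const>\<open>graph\<close>:
  finite digraphs without loops or parallel arcs whose adjacency relation is symmetric, so that
  an undirected edge is a pair of opposite arcs. Hence the degree of a vertex, as an undirected
  graph, is its out-degree (equal to its in-degree).
\<close>

definition dominating_set :: "('a, 'b) pre_digraph \<Rightarrow> 'a set \<Rightarrow> bool" where
  "dominating_set G S \<longleftrightarrow>
     S \<subseteq> verts G \<and> (\<forall>v \<in> verts G - S. \<exists>u \<in> S. v \<rightarrow>\<^bsub>G\<^esub> u)"

definition domination_number :: "('a, 'b) pre_digraph \<Rightarrow> nat" where
  "domination_number G = (LEAST k. \<exists>S. dominating_set G S \<and> card S = k)"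

text \<open>The filter describing \<open>n \<rightarrow> \<infinity>\<close> with \<open>n\<close> restricted to \<open>I\<close>.\<close>

abbreviation at_top_in :: "nat set \<Rightarrow> nat filter" where
  "at_top_in I \<equiv> inf at_top (principal I)"

end

theory Submission
  imports Defs
begin

text \<open>
  Call a vertex low if its degree is at most \<open>\<surd>n / \<omega>\<close>. Since \<open>\<omega>\<close> tends to infinity this threshold
  is \<open>o(\<surd>n)\<close>, so by hypothesis there are only \<open>O(\<surd>n)\<close> low vertices, and all of them can be put
  into the dominating set. Every other vertex has more than \<open>d = \<surd>n / \<omega>\<close> neighbours, and such
  vertices are dominated greedily: by averaging, some vertex is adjacent to at least a fraction
  \<open>d / n\<close> of the vertices not dominated so far, so each choice multiplies the number of those
  by at most \<open>1 - d / n \<le> exp (- d / n)\<close>. After about \<open>(n / d) ln n = \<omega> \<surd>n ln n\<close> choices at most one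
  vertex is left (\<open>greedy_cover\<close>). The two parts together have \<open>O(\<omega> \<surd>n log n)\<close> vertices
  (\<open>domination_number_le\<close>).
\<close>

text \<open>
  Double counting: the sets \<open>N v\<close>, \<open>v \<in> R\<close>, contain at least \<open>d * card R\<close> elements of \<open>V\<close> with
  multiplicity, so some element of \<open>V\<close> has at least the average multiplicity.
\<close>

lemma exists_popular_element:
  fixes N :: "'a \<Rightarrow> 'b set" and d :: real
  assumes "finite V" "V \<noteq> {}" "finite R"
    and N: "\<And>v. v \<in> R \<Longrightarrow> N v \<subseteq> V" "\<And>v. v \<in> R \<Longrightarrow> d \<le> real (card (N v))"
  shows "\<exists>u\<in>V. d * real (card R) \<le> real (card V) * real (card {v\<in>R. u \<in> N v})"
proof (rule ccontr)
  assume "\<not> ?thesis"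
  then have less: "real (card V) * real (card {v\<in>R. u \<in> N v}) < d * real (card R)" if "u \<in> V" for u
    using that by force
  have double_count: "(\<Sum>u\<in>V. card {v\<in>R. u \<in> N v}) = (\<Sum>v\<in>R. card (N v))"
  proof -
    have "(\<Sum>u\<in>V. card {v\<in>R. u \<in> N v}) = (\<Sum>v\<in>R. card {u\<in>V. u \<in> N v})"
      using assms(1,3) by (intro sum_multicount_gen) auto
    also have "\<dots> = (\<Sum>v\<in>R. card (N v))"
      using N(1) by (intro sum.cong refl arg_cong[where f = card]) auto
    finally show ?thesis .
  qed
  have "real (card V) * (\<Sum>u\<in>V. real (card {v\<in>R. u \<in> N v}))
          = (\<Sum>u\<in>V. real (card V) * real (card {v\<in>R. u \<in> N v}))"
    by (rule sum_distrib_left)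
  also have "\<dots> < (\<Sum>u\<in>V. d * real (card R))"
    using assms(1,2) less by (intro sum_strict_mono) auto
  also have "\<dots> = real (card V) * (d * real (card R))"
    by simp
  also have "d * real (card R) \<le> (\<Sum>v\<in>R. real (card (N v)))"
    using sum_mono[of R "\<lambda>_. d" "\<lambda>v. real (card (N v))"] N(2) by (simp add: mult.commute)
  also have "\<dots> = (\<Sum>u\<in>V. real (card {v\<in>R. u \<in> N v}))"
    using arg_cong[OF double_count, of real] by simp
  finally show False
    by (simp add: mult_left_mono)
qed

text \<open>
  By \<open>exists_popular_element\<close>, some element of \<open>V\<close> hits at least a fraction \<open>d / card V\<close> of the
  sets \<open>N v\<close> still missed by \<open>S\<close>. Each step adds such an element.
\<close>

lemma greedy_steps:
  fixes N :: "'a \<Rightarrow> 'b set" and d :: real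
  assumes "finite V" "V \<noteq> {}" "finite U"
    and N: "\<And>v. v \<in> U \<Longrightarrow> N v \<subseteq> V" "\<And>v. v \<in> U \<Longrightarrow> d \<le> real (card (N v))"
  shows "\<exists>S\<subseteq>V. card S \<le> k \<and>
           real (card {v\<in>U. N v \<inter> S = {}}) \<le> real (card U) * exp (- d / real (card V)) ^ k"
proof (induction k)
  case 0
  then show ?case
    by (intro exI[of _ "{}"]) simp
next
  case (Suc k)
  then obtain S where S: "S \<subseteq> V" "card S \<le> k"
    and left: "real (card {v\<in>U. N v \<inter> S = {}}) \<le> real (card U) * exp (- d / real (card V)) ^ k"
    by blast
  define R where "R = {v\<in>U. N v \<inter> S = {}}"
  have "finite R"
    using assms(3) by (simp add: R_def)
  obtain u where u: "u \<in> V" "d * real (card R) \<le> real (card V) * real (card {v\<in>R. u \<in> N v})"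
    using exists_popular_element[of V R N d] assms \<open>finite R\<close> unfolding R_def by auto
  have V_pos: "real (card V) > 0"
    using assms(1,2) by (simp add: card_gt_0_iff)
  have "{v\<in>U. N v \<inter> insert u S = {}} = R - {v\<in>R. u \<in> N v}"
    by (auto simp: R_def)
  then have "real (card {v\<in>U. N v \<inter> insert u S = {}}) = real (card R) - real (card {v\<in>R. u \<in> N v})"
    using \<open>finite R\<close> by (simp add: card_Diff_subset card_mono of_nat_diff)
  also have "\<dots> \<le> real (card R) * (1 + - d / real (card V))"
    using u(2) V_pos by (simp add: field_simps)
  also have "\<dots> \<le> real (card R) * exp (- d / real (card V))"
    by (intro mult_left_mono exp_ge_add_one_self) simp
  also have "\<dots> \<le> real (card U) * exp (- d / real (card V)) ^ k * exp (- d / real (card V))"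
    using left by (intro mult_right_mono) (simp_all add: R_def)
  finally have "real (card {v\<in>U. N v \<inter> insert u S = {}})
                  \<le> real (card U) * exp (- d / real (card V)) ^ Suc k"
    by (simp add: mult_ac)
  moreover have "card (insert u S) \<le> Suc k"
    using S(2) finite_subset[OF S(1) assms(1)] by (simp add: card_insert_if)
  ultimately show ?case
    using S(1) u(1) by (intro exI[of _ "insert u S"]) simp
qed

text \<open>
  After \<open>k = \<lceil>(n / d) ln n\<rceil>\<close> greedy choices the bound \<open>n * exp (- d * k / n)\<close> on the number of
  elements \<open>v\<close> whose set \<open>N v\<close> is not yet hit has dropped to \<open>1\<close>. Such an element is added to \<open>S\<close>
  itself. This and the rounding of \<open>k\<close> account for the summand \<open>2\<close>.
\<close>

lemma greedy_cover:
  fixes N :: "'a \<Rightarrow> 'a set" and d :: real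
  assumes "finite V" "V \<noteq> {}" "U \<subseteq> V" "d > 0"
    and N: "\<And>v. v \<in> U \<Longrightarrow> N v \<subseteq> V" "\<And>v. v \<in> U \<Longrightarrow> d \<le> real (card (N v))"
  shows "\<exists>S\<subseteq>V. real (card S) \<le> real (card V) / d * ln (real (card V)) + 2 \<and>
           (\<forall>v\<in>U - S. N v \<inter> S \<noteq> {})"
proof -
  define n where "n = real (card V)"
  define k where "k = nat \<lceil>n / d * ln n\<rceil>"
  have "n \<ge> 1"
    using assms(1,2) by (simp add: n_def Suc_le_eq card_gt_0_iff)
  then have "n / d * ln n \<ge> 0"
    using assms(4) by simp
  then have k: "n / d * ln n \<le> real k" "real k \<le> n / d * ln n + 1"
    unfolding k_def by linarith+
  obtain S where S: "S \<subseteq> V" "card S \<le> k"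
    and left: "real (card {v\<in>U. N v \<inter> S = {}}) \<le> real (card U) * exp (- d / n) ^ k"
    using greedy_steps[of V U N d k] assms finite_subset[OF assms(3,1)] unfolding n_def by blast
  define R where "R = {v\<in>U. N v \<inter> S = {}}"
  have "ln n \<le> d / n * real k"
    using k(1) \<open>n \<ge> 1\<close> assms(4) by (simp add: field_simps)
  then have "exp (- d / n) ^ k \<le> exp (- ln n)"
    by (simp add: mult.commute flip: exp_of_nat_mult)
  also have "\<dots> = 1 / n"
    using \<open>n \<ge> 1\<close> by (simp add: exp_minus inverse_eq_divide)
  finally have "real (card U) * exp (- d / n) ^ k \<le> n * (1 / n)"
    using card_mono[OF assms(1,3)] by (intro mult_mono) (auto simp: n_def)
  then have "real (card R) \<le> 1"
    using left \<open>n \<ge> 1\<close> by (simp add: R_def)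
  moreover have "card (S \<union> R) \<le> card S + card R"
    by (rule card_Un_le)
  ultimately have "real (card (S \<union> R)) \<le> n / d * ln n + 2"
    using S(2) k(2) by linarith
  moreover have "S \<union> R \<subseteq> V"
    using S(1) assms(3) by (auto simp: R_def)
  moreover have "\<forall>v\<in>U - (S \<union> R). N v \<inter> (S \<union> R) \<noteq> {}"
    by (auto simp: R_def)
  ultimately show ?thesis
    unfolding n_def by blast
qed

text \<open>Parallel arcs are excluded, so distinct arcs leaving a vertex have distinct heads.\<close>

lemma (in digraph) card_out_neighbours:
  "card {u. v \<rightarrow>\<^bsub>G\<^esub> u} = out_degree G v"
proof -
  have "bij_betw (head G) (out_arcs G v) {u. v \<rightarrow>\<^bsub>G\<^esub> u}"
    unfolding bij_betw_def
  proof
    show "inj_on (head G) (out_arcs G v)"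
      using no_multi_arcs by (auto simp: inj_on_def arc_to_ends_def)
    show "head G ` out_arcs G v = {u. v \<rightarrow>\<^bsub>G\<^esub> u}"
      by (force simp: arcs_ends_def arc_to_ends_def)
  qed
  then show ?thesis
    unfolding out_degree_def by (simp add: bij_betw_same_card)
qed

lemma domination_number_le:
  fixes d :: real
  assumes "digraph G" "verts G \<noteq> {}" "d > 0"
  shows "real (domination_number G)
           \<le> real (card {v \<in> verts G. real (out_degree G v) \<le> d})
               + real (card (verts G)) / d * ln (real (card (verts G))) + 2"
proof -
  interpret digraph G by fact
  define L where "L = {v \<in> verts G. real (out_degree G v) \<le> d}"
  have "{u. v \<rightarrow>\<^bsub>G\<^esub> u} \<subseteq> verts G" for v
    by (auto dest: adj_in_verts)
  moreover have "d \<le> real (card {u. v \<rightarrow>\<^bsub>G\<^esub> u})" if "v \<in> verts G - L" for v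
    using that by (auto simp: L_def card_out_neighbours)
  ultimately obtain S where S: "S \<subseteq> verts G"
    "real (card S) \<le> real (card (verts G)) / d * ln (real (card (verts G))) + 2"
    "\<forall>v\<in>verts G - L - S. {u. v \<rightarrow>\<^bsub>G\<^esub> u} \<inter> S \<noteq> {}"
    using greedy_cover[of "verts G" "verts G - L" d "\<lambda>v. {u. v \<rightarrow>\<^bsub>G\<^esub> u}"] assms(2,3) finite_verts
    by auto
  have "dominating_set G (L \<union> S)"
    using S(1,3) unfolding dominating_set_def L_def by blast
  then have "domination_number G \<le> card (L \<union> S)"
    unfolding domination_number_def by (intro Least_le) blast
  also have "\<dots> \<le> card L + card S"
    by (rule card_Un_le)
  finally show ?thesis
    using S(2) unfolding L_def by linarith
qed

theorem theorem15:
  fixes I :: "nat set"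
    and \<omega> :: "nat \<Rightarrow> int"
    and G :: "nat \<Rightarrow> ('a, 'b) pre_digraph"
  assumes "infinite I" and "\<forall>n \<in> I. n > 0"
    and "mono_on I \<omega>" and "filterlim \<omega> at_top (at_top_in I)"
    and "\<forall>n \<in> I. graph (G n) \<and> Digraph_Component.connected (G n) \<and> card (verts (G n)) = n"
    and "\<forall>f :: nat \<Rightarrow> real. (\<forall>n. f n \<ge> 0) \<longrightarrow> f \<in> o[at_top_in I](\<lambda>n. sqrt (real n)) \<longrightarrow>
           (\<lambda>n. real (card {v \<in> verts (G n). real (out_degree (G n) v) \<le> f n}))
             \<in> O[at_top_in I](\<lambda>n. sqrt (real n))"
  shows "(\<lambda>n. real (domination_number (G n)))
           \<in> O[at_top_in I](\<lambda>n. real_of_int (\<omega> n) * sqrt (real n) * log 2 (real n))"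
proof -
  \<comment> \<open>The maximum keeps the denominator positive where \<open>\<omega> n \<le> 0\<close>.\<close>
  define f where "f n = sqrt (real n) / real_of_int (max 1 (\<omega> n))" for n
  define low where "low n = card {v \<in> verts (G n). real (out_degree (G n) v) \<le> f n}" for n
  have \<omega>_large: "eventually (\<lambda>n. \<omega> n \<ge> c) (at_top_in I)" for c
    using assms(4) by (auto simp: filterlim_at_top)
  have "f \<in> o[at_top_in I](\<lambda>n. sqrt (real n))"
  proof (rule landau_o.smallI)
    fix c :: real assume "c > 0"
    show "eventually (\<lambda>n. norm (f n) \<le> c * norm (sqrt (real n))) (at_top_in I)"
      using \<omega>_large[of "max 1 \<lceil>1 / c\<rceil>"]
    proof eventually_elim
      case (elim n)
      then have "1 / c \<le> real_of_int (\<omega> n)" "\<omega> n \<ge> 1"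
        by linarith+
      then have "1 \<le> c * real_of_int (\<omega> n)"
        using \<open>c > 0\<close> by (simp add: field_simps)
      then have "sqrt (real n) * 1 \<le> sqrt (real n) * (c * real_of_int (\<omega> n))"
        by (intro mult_left_mono) auto
      then show ?case
        using \<open>\<omega> n \<ge> 1\<close> by (simp add: f_def max_def field_simps)
    qed
  qed
  moreover have "\<forall>n. f n \<ge> 0"
    by (simp add: f_def)
  ultimately have "(\<lambda>n. real (low n)) \<in> O[at_top_in I](\<lambda>n. sqrt (real n))"
    using assms(6) unfolding low_def by blast
  then obtain C where "C > 0"
    and low: "eventually (\<lambda>n. real (low n) \<le> C * sqrt (real n)) (at_top_in I)"
    by (elim landau_o.bigE) auto
  have in_I: "eventually (\<lambda>n. n \<in> I) (at_top_in I)"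
    by (simp add: eventually_inf_principal)
  have n_large: "eventually (\<lambda>n. n \<ge> 2) (at_top_in I)"
    unfolding eventually_inf_principal by (rule eventually_mono[OF eventually_ge_at_top[of 2]]) simp
  show ?thesis
  proof (rule landau_o.bigI)
    show "C + 3 > 0"
      using \<open>C > 0\<close> by simp
    show "eventually (\<lambda>n. norm (real (domination_number (G n)))
            \<le> (C + 3) * norm (real_of_int (\<omega> n) * sqrt (real n) * log 2 (real n))) (at_top_in I)"
      using low in_I n_large \<omega>_large[of 1]
    proof eventually_elim
      case (elim n)
      define w where "w = real_of_int (\<omega> n)"
      define s where "s = sqrt (real n)"
      define l where "l = log 2 (real n)"
      have w: "w \<ge> 1" and s: "s \<ge> 1" and l: "l \<ge> 1"
        using elim by (auto simp: w_def s_def l_def le_log_iff)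
      have f: "f n = s / w"
        using elim(4) by (simp add: f_def s_def w_def)
      have "ln (real n) \<le> l"
      proof -
        have "ln (real n) * ln 2 \<le> ln (real n) * 1"
          using elim(3) ln_le_minus_one[of "2::real"] by (intro mult_left_mono) auto
        then show ?thesis
          by (simp add: l_def log_def field_simps)
      qed
      have G: "digraph (G n)" "card (verts (G n)) = n"
        using assms(5) elim(2) by (auto simp: graph_def)
      have "f n > 0" "verts (G n) \<noteq> {}"
        using s w G(2) elim(3) by (auto simp: f)
      then have "real (domination_number (G n)) \<le> real (low n) + real n / f n * ln (real n) + 2"
        using domination_number_le[OF G(1), of "f n"] by (simp add: low_def G(2))
      also have "real n / f n = w * s"
        using s w by (simp add: f field_simps) (simp add: s_def flip: power2_eq_square)
      also have "w * s * ln (real n) \<le> w * s * l"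
        using \<open>ln (real n) \<le> l\<close> w s by (intro mult_left_mono) auto
      also have "real (low n) \<le> C * (w * s * l)"
      proof -
        have "1 * s * 1 \<le> w * s * l"
          using w s l by (intro mult_mono) auto
        then have "C * s \<le> C * (w * s * l)"
          using \<open>C > 0\<close> by (intro mult_left_mono) auto
        then show ?thesis
          using elim(1) by (simp add: s_def)
      qed
      also have "2 \<le> 2 * (w * s * l)"
        using mult_mono[of 1 w 1 s] mult_mono[of 1 "w * s" 1 l] w s l by simp
      finally have "real (domination_number (G n)) \<le> (C + 3) * (w * s * l)"
        by (simp add: algebra_simps)
      then show ?case
        using w s l by (simp add: w_def s_def l_def abs_mult)
    qed
  qed
qed

end
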